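(* Let $n \geq 2$, let $d_0 \geq d_1 \geq \cdots \geq d_n \geq 2$ be integers, and set $t = d_0 + \cdots + d_n - (n+1)$. Let $K$ be an infinite field of characteristic $p$, where $p$ is a positive prime, let $R = K[x_0,\ldots,x_n]$, $I_{\underline{d}} = (x_0^{d_0}, \ldots, x_n^{d_n})$, and $\ell = x_0 + \cdots + x_n$. Suppose $d_0 \leq \left\lceil \frac{t}{2} \right\rceil$. Then: (i) If $d_1 \leq p \leq d_0$, or $d_0 \leq p^m \leq \left\lceil \frac{t}{2} \right\rceil$ for some positive integer $m$, then $R/I_{\underline{d}}$ fails to have the weak Lefschetz property. In particular, in the first case the map $\times \ell : [R/I_{\underline{d}}]_{d_0-1} \rightarrow [R/I_{\underline{d}}]_{d_0}$ is not injective, and in the second case the map $\times \ell : [R/I_{\underline{d}}]_{p^m-1} \rightarrow [R/I_{\underline{d}}]_{p^m}$ is not injective. (ii) If $p > \left\lceil \frac{t+1}{2} \right\rceil$, then $R/I_{\underline{d}}$ has the weak Lefschetz property.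
   Context: $R$ is standard graded and $[A]_d$ denotes the degree $d$ component of a graded algebra $A$. An artinian standard graded $K$-algebra $A$ has the weak Lefschetz property if there exists a linear form $\ell \in A$ such that for all integers $d$ the multiplication map $\times \ell : [A]_d \rightarrow [A]_{d+1}$ has maximal rank (i.e. is injective or surjective). The number $t$ is the socle degree of $R/I_{\underline{d}}$. *)

theory Defs
  imports Complex_Main "HOL-Library.Poly_Mapping" "HOL-Algebra.QuotRing"
    "HOL-Computational_Algebra.Primes"
begin

(* A monomial is its finitely supported exponent vector; a polynomial is a finitely supported
   family of coefficients indexed by monomials. The type has infinitely many variables x_0, x_1, ...;
   K[x_0,...,x_n] is the carrier of poly_ring n. *)
type_synonym 'k mpolynomial = "(nat \<Rightarrow>\<^sub>0 nat) \<Rightarrow>\<^sub>0 'k"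

definition poly_ring :: "nat \<Rightarrow> 'k::comm_ring_1 mpolynomial ring" where
  "poly_ring n = \<lparr>carrier = {f. \<forall>m\<in>Poly_Mapping.keys f. Poly_Mapping.keys m \<subseteq> {..n}},
     monoid.mult = (*), one = 1, zero = 0, add = (+)\<rparr>"

definition var :: "nat \<Rightarrow> 'k::comm_ring_1 mpolynomial" where
  "var i = Poly_Mapping.single (Poly_Mapping.single i 1) 1"

definition mon_degree :: "(nat \<Rightarrow>\<^sub>0 nat) \<Rightarrow> nat" where
  "mon_degree m = (\<Sum>i\<in>Poly_Mapping.keys m. Poly_Mapping.lookup m i)"

(* Degrees range over all integers; in negative degrees only the zero polynomial is homogeneous. *)
definition homogeneous_polys :: "nat \<Rightarrow> int \<Rightarrow> 'k::comm_ring_1 mpolynomial set" where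
  "homogeneous_polys n j = {f \<in> carrier (poly_ring n). \<forall>m\<in>Poly_Mapping.keys f. int (mon_degree m) = j}"

(* [R/J]_j for a homogeneous ideal J of R = K[x_0,...,x_n]: the image of [R]_j in R/J. *)
definition quotient_component ::
    "nat \<Rightarrow> 'k::comm_ring_1 mpolynomial set \<Rightarrow> int \<Rightarrow> 'k mpolynomial set set" where
  "quotient_component n J j = (\<lambda>f. J +>\<^bsub>poly_ring n\<^esub> f) ` homogeneous_polys n j"

definition monomial_ci_ideal :: "nat \<Rightarrow> (nat \<Rightarrow> nat) \<Rightarrow> 'k::comm_ring_1 mpolynomial set" where
  "monomial_ci_ideal n d = Idl\<^bsub>poly_ring n\<^esub> {var i ^ d i | i. i \<le> n}"

(* A is a ring with grading G, so G j is the component [A]_j; the property is meant for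
   artinian standard graded algebras. Since [A]_j is mapped into [A]_{j+1} by a linear form,
   surjectivity is equality of the image with G (j + 1). *)
definition weak_Lefschetz :: "('a, 'b) ring_scheme \<Rightarrow> (int \<Rightarrow> 'a set) \<Rightarrow> bool" where
  "weak_Lefschetz A G \<longleftrightarrow>
     (\<exists>l\<in>G 1. \<forall>j. inj_on (\<lambda>a. l \<otimes>\<^bsub>A\<^esub> a) (G j) \<or> (\<lambda>a. l \<otimes>\<^bsub>A\<^esub> a) ` G j = G (j + 1))"

lemma cring_poly_ring: "cring (poly_ring n :: 'k::comm_ring_1 mpolynomial ring)"
proof (rule cringI)
  let ?R = "poly_ring n :: 'k mpolynomial ring"
  have add: "f + g \<in> carrier ?R" if "f \<in> carrier ?R" "g \<in> carrier ?R" for f g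
    using that keys_add[of f g] by (auto simp: poly_ring_def)
  have mult: "f * g \<in> carrier ?R" if fg: "f \<in> carrier ?R" "g \<in> carrier ?R" for f g
  proof -
    have "Poly_Mapping.keys m \<subseteq> {..n}" if "m \<in> Poly_Mapping.keys (f * g)" for m
    proof -
      obtain a b where "m = a + b" "a \<in> Poly_Mapping.keys f" "b \<in> Poly_Mapping.keys g"
        using keys_mult[of f g] \<open>m \<in> Poly_Mapping.keys (f * g)\<close> by blast
      then show ?thesis
        using fg keys_add[of a b] by (fastforce simp: poly_ring_def)
    qed
    then show ?thesis
      by (simp add: poly_ring_def)
  qed
  have minus: "- f \<in> carrier ?R" if "f \<in> carrier ?R" for f
    using that by (auto simp: poly_ring_def in_keys_iff)
  have sel: "monoid.mult ?R = (*)" "one ?R = 1" "zero ?R = 0" "add ?R = (+)"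
    by (simp_all add: poly_ring_def)
  have one_zero: "1 \<in> carrier ?R" "0 \<in> carrier ?R"
    by (auto simp: poly_ring_def)
  show "abelian_group ?R"
  proof (rule abelian_groupI)
    show "\<exists>y\<in>carrier ?R. y \<oplus>\<^bsub>?R\<^esub> x = \<zero>\<^bsub>?R\<^esub>" if "x \<in> carrier ?R" for x
      using minus[OF that] by (intro bexI[of _ "- x"]) (simp_all add: sel)
  qed (simp_all only: sel add one_zero ac_simps add_0_left add_0_right)
  show "comm_monoid ?R"
    by (rule comm_monoidI) (simp_all add: sel mult one_zero mult_ac)
qed (simp add: poly_ring_def distrib_right)

lemma var_power_in_carrier: "i \<le> n \<Longrightarrow> var i ^ k \<in> carrier (poly_ring n)"
proof -
  assume "i \<le> n"
  have "(var i :: 'a mpolynomial) ^ k = Poly_Mapping.single (Poly_Mapping.single i k) 1"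
    by (induction k) (auto simp: var_def mult_single simp flip: single_add)
  with \<open>i \<le> n\<close> show ?thesis
    by (auto simp: poly_ring_def split: if_splits)
qed

lemma ideal_monomial_ci_ideal: "ideal (monomial_ci_ideal n d) (poly_ring n)"
proof -
  interpret cring "poly_ring n" by (rule cring_poly_ring)
  show ?thesis
    unfolding monomial_ci_ideal_def
    by (rule genideal_ideal) (auto intro: var_power_in_carrier)
qed

lemma homogeneous_polys_mult:
  assumes f: "f \<in> homogeneous_polys n i" and g: "g \<in> homogeneous_polys n j"
  shows "f * g \<in> homogeneous_polys n (i + j)"
proof -
  interpret cring "poly_ring n" by (rule cring_poly_ring)
  have deg: "mon_degree (a + b) = mon_degree a + mon_degree b" for a b
  proof -
    have *: "mon_degree m = (\<Sum>i\<in>Poly_Mapping.keys a \<union> Poly_Mapping.keys b. Poly_Mapping.lookup m i)"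
      if "Poly_Mapping.keys m \<subseteq> Poly_Mapping.keys a \<union> Poly_Mapping.keys b" for m
      unfolding mon_degree_def using that
      by (intro sum.mono_neutral_left) (auto simp: in_keys_iff)
    show ?thesis
      by (simp add: * keys_add lookup_add sum.distrib)
  qed
  have "f \<otimes>\<^bsub>poly_ring n\<^esub> g \<in> carrier (poly_ring n)"
    using f g by (intro m_closed) (auto simp: homogeneous_polys_def)
  moreover have "int (mon_degree m) = i + j" if "m \<in> Poly_Mapping.keys (f * g)" for m
  proof -
    obtain a b where "m = a + b" "a \<in> Poly_Mapping.keys f" "b \<in> Poly_Mapping.keys g"
      using keys_mult[of f g] \<open>m \<in> Poly_Mapping.keys (f * g)\<close> by blast
    then show ?thesis
      using f g by (simp add: homogeneous_polys_def deg)
  qed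
  ultimately show ?thesis
    by (simp add: homogeneous_polys_def poly_ring_def)
qed

lemma quotient_component_mult:
  assumes "a \<in> quotient_component n (monomial_ci_ideal n d) i"
    and "b \<in> quotient_component n (monomial_ci_ideal n d) j"
  shows "a \<otimes>\<^bsub>poly_ring n Quot monomial_ci_ideal n d\<^esub> b
           \<in> quotient_component n (monomial_ci_ideal n d) (i + j)"
proof -
  interpret ideal "monomial_ci_ideal n d" "poly_ring n" by (rule ideal_monomial_ci_ideal)
  obtain f g where "f \<in> homogeneous_polys n i" "g \<in> homogeneous_polys n j"
    and "a = monomial_ci_ideal n d +>\<^bsub>poly_ring n\<^esub> f"
    and "b = monomial_ci_ideal n d +>\<^bsub>poly_ring n\<^esub> g"
    using assms by (auto simp: quotient_component_def)
  moreover from this have "f \<otimes>\<^bsub>poly_ring n\<^esub> g \<in> homogeneous_polys n (i + j)"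
    using homogeneous_polys_mult by (simp add: poly_ring_def)
  ultimately show ?thesis
    by (auto simp: quotient_component_def FactRing_def rcoset_mult_add homogeneous_polys_def)
qed

end

theory Submission
  imports Defs
begin

text \<open>
  Write \<open>A = R/I\<close>, with socle in degree \<open>t\<close>. A nonzero element of degree \<open>j < t\<close> stays nonzero under
  multiplication by some variable. Hence injectivity of \<open>\<times>L\<close> in a degree \<open>j \<le> t\<close> propagates to lower
  degrees, and, by the pairing into the socle, surjectivity in degree \<open>j\<close> implies injectivity in
  degree \<open>t - 1 - j\<close>.

  (i) Let \<open>q = p^m\<close> and \<open>q \<ge> d\<^sub>1\<close>. By the Frobenius homomorphism every linear form \<open>L\<close> satisfies
  \<open>L^q x\<^sub>0^(d\<^sub>0 - q) = 0\<close> in \<open>A\<close> (where the exponent is read as 0 if \<open>q \<ge> d\<^sub>0\<close>). As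
  \<open>x\<^sub>0^(d\<^sub>0 - q) \<noteq> 0\<close>, some \<open>L^k x\<^sub>0^(d\<^sub>0 - q)\<close> with \<open>k < q\<close> is a nonzero element killed by \<open>L\<close>, so
  \<open>\<times>L\<close> is not injective in degree \<open>max d\<^sub>0 q - 1\<close>; this degree is below \<open>t/2\<close>, so \<open>\<times>L\<close> is not
  surjective there either.

  (ii) \<open>A\<close> carries an \<open>sl\<^sub>2\<close>-action with raising operator \<open>\<times>\<ell>\<close> and lowering operator
  \<open>F x^a = \<Sum> a\<^sub>i (d\<^sub>i - a\<^sub>i) x^(a - e\<^sub>i)\<close>. In degree \<open>j\<close> one has
  \<open>F^k \<ell> - \<ell> F^k = k (t - 2j + k - 1) F^(k - 1)\<close>, and next to the middle degree the bound on \<open>p\<close> makes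
  all coefficients that occur invertible. If \<open>\<ell> f = 0\<close>, descending induction on \<open>k\<close> gives
  \<open>F^k f = 0\<close> down to \<open>k = 0\<close>; dually, \<open>F^k h\<close> lies in the image of \<open>\<ell>\<close> for all \<open>h\<close> of the
  appropriate degree, down to \<open>k = 0\<close>.
\<close>

section \<open>Monomials and homogeneous polynomials\<close>

lemma lookup_single_mult_add:
  fixes f :: "'a::cancel_comm_monoid_add \<Rightarrow>\<^sub>0 'b::semiring_0"
  shows "Poly_Mapping.lookup (Poly_Mapping.single a c * f) (a + m) = c * Poly_Mapping.lookup f m"
  by (simp add: lookup_mult lookup_single when_mult)

lemma lookup_var_mult_eq_0:
  "Poly_Mapping.lookup m i = 0 \<Longrightarrow> Poly_Mapping.lookup (var i * f) m = 0"
proof -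
  assume m: "Poly_Mapping.lookup m i = 0"
  then have "m \<noteq> Poly_Mapping.single i 1 + q" for q
    by (metis add_is_0 lookup_add lookup_single_eq one_neq_zero)
  then show ?thesis
    by (simp add: var_def lookup_mult lookup_single when_mult)
qed

lemma lookup_var_mult_add:
  "Poly_Mapping.lookup (var i * f) (m + Poly_Mapping.single i 1) = Poly_Mapping.lookup f m"
  using lookup_single_mult_add[of "Poly_Mapping.single i 1" 1 f m] by (simp add: var_def add.commute)

lemma sub_single_add:
  fixes m :: "'a \<Rightarrow>\<^sub>0 nat"
  shows "Poly_Mapping.lookup m i \<noteq> 0 \<Longrightarrow> m - Poly_Mapping.single i 1 + Poly_Mapping.single i 1 = m"
  by (rule poly_mapping_eqI) (auto simp: lookup_add lookup_minus lookup_single when_def)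

lemma lookup_var_mult:
  "Poly_Mapping.lookup (var i * f) m =
     (if Poly_Mapping.lookup m i = 0 then 0 else Poly_Mapping.lookup f (m - Poly_Mapping.single i 1))"
  using lookup_var_mult_eq_0[of m i f] lookup_var_mult_add[of i f "m - Poly_Mapping.single i 1"]
    sub_single_add[of m i] by auto

lemma lookup_of_int_mult:
  "Poly_Mapping.lookup (of_int c * f) m = of_int c * Poly_Mapping.lookup f m"
  for f :: "'k::comm_ring_1 mpolynomial"
  using lookup_single_mult_add[of 0 "of_int c" f m] by simp

lemma mon_degree_add: "mon_degree (a + b) = mon_degree a + mon_degree b"
proof -
  have *: "mon_degree m = (\<Sum>i\<in>Poly_Mapping.keys a \<union> Poly_Mapping.keys b. Poly_Mapping.lookup m i)"
    if "Poly_Mapping.keys m \<subseteq> Poly_Mapping.keys a \<union> Poly_Mapping.keys b" for m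
    unfolding mon_degree_def using that
    by (intro sum.mono_neutral_left) (auto simp: in_keys_iff)
  show ?thesis
    by (simp add: * keys_add lookup_add sum.distrib)
qed

lemma mon_degree_single [simp]: "mon_degree (Poly_Mapping.single i k) = k"
  by (simp add: mon_degree_def)

lemma mon_degree_atMost:
  "Poly_Mapping.keys m \<subseteq> {..n} \<Longrightarrow> mon_degree m = (\<Sum>i\<le>n. Poly_Mapping.lookup m i)"
  unfolding mon_degree_def by (intro sum.mono_neutral_left) (auto simp: in_keys_iff)

lemma homogeneous_polys_iff:
  "f \<in> homogeneous_polys n j \<longleftrightarrow>
     (\<forall>m\<in>Poly_Mapping.keys f. Poly_Mapping.keys m \<subseteq> {..n} \<and> int (mon_degree m) = j)"
  by (auto simp: homogeneous_polys_def poly_ring_def)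

lemma homogeneous_polys_carrier: "f \<in> homogeneous_polys n j \<Longrightarrow> f \<in> carrier (poly_ring n)"
  by (simp add: homogeneous_polys_def)

lemma homogeneous_polys_zero: "0 \<in> homogeneous_polys n j"
  by (simp add: homogeneous_polys_iff)

lemma homogeneous_polys_neg: "j < 0 \<Longrightarrow> f \<in> homogeneous_polys n j \<longleftrightarrow> f = 0"
proof
  assume j: "j < 0" and f: "f \<in> homogeneous_polys n j"
  then have "Poly_Mapping.keys f = {}" by (auto simp: homogeneous_polys_iff)
  then show "f = 0" by simp
qed (simp add: homogeneous_polys_zero)

lemma homogeneous_polys_add:
  "f \<in> homogeneous_polys n j \<Longrightarrow> g \<in> homogeneous_polys n j \<Longrightarrow> f + g \<in> homogeneous_polys n j"
  using keys_add[of f g] by (auto simp: homogeneous_polys_iff)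

lemma homogeneous_polys_uminus:
  "f \<in> homogeneous_polys n j \<Longrightarrow> - f \<in> homogeneous_polys n j"
  by (auto simp: homogeneous_polys_iff in_keys_iff)

lemma homogeneous_polys_diff:
  "f \<in> homogeneous_polys n j \<Longrightarrow> g \<in> homogeneous_polys n j \<Longrightarrow> f - g \<in> homogeneous_polys n j"
  using homogeneous_polys_add[of f n j "- g"] by (simp add: homogeneous_polys_uminus)

lemma homogeneous_polys_sum:
  "(\<And>i. i \<in> S \<Longrightarrow> f i \<in> homogeneous_polys n j) \<Longrightarrow> sum f S \<in> homogeneous_polys n j"
  by (induction S rule: infinite_finite_induct)
    (auto intro: homogeneous_polys_zero homogeneous_polys_add)

lemma homogeneous_polys_single:
  "Poly_Mapping.keys m \<subseteq> {..n} \<Longrightarrow> int (mon_degree m) = j \<Longrightarrow>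
     Poly_Mapping.single m c \<in> homogeneous_polys n j"
  by (auto simp: homogeneous_polys_iff split: if_splits)

lemma homogeneous_polys_one: "1 \<in> homogeneous_polys n 0"
  using homogeneous_polys_single[of 0 n 0 1] by (simp add: mon_degree_def)

lemma homogeneous_polys_var: "i \<le> n \<Longrightarrow> var i \<in> homogeneous_polys n 1"
  unfolding var_def by (intro homogeneous_polys_single) auto

lemma homogeneous_polys_power:
  "f \<in> homogeneous_polys n j \<Longrightarrow> f ^ k \<in> homogeneous_polys n (int k * j)"
proof (induction k)
  case (Suc k)
  then show ?case
    using homogeneous_polys_mult[of f n j "f ^ k" "int k * j"] by (simp add: algebra_simps)
qed (simp add: homogeneous_polys_one)

lemma homogeneous_polys_const_mult:
  "f \<in> homogeneous_polys n j \<Longrightarrow> Poly_Mapping.single 0 c * f \<in> homogeneous_polys n j"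
  using homogeneous_polys_mult[of "Poly_Mapping.single 0 c" n 0 f j]
    homogeneous_polys_single[of 0 n 0 c] by (simp add: mon_degree_def)

lemma var_power: "var i ^ k = Poly_Mapping.single (Poly_Mapping.single i k) 1"
  by (induction k) (auto simp: var_def mult_single simp flip: single_add)

lemma poly_mapping_sum_single:
  "f = (\<Sum>m\<in>Poly_Mapping.keys f. Poly_Mapping.single m (Poly_Mapping.lookup f m))"
  by (rule poly_mapping_eqI)
    (auto simp: lookup_sum lookup_single when_def in_keys_iff sum.delta)

section \<open>The monomial complete intersection\<close>

text \<open>Membership is a condition on the support alone, and variables beyond \<open>x_n\<close>
  are allowed. This gives an ideal of the whole polynomial type, so computations modulo
  \<open>I\<close> need no carrier conditions; intersecting with \<open>K[x_0,...,x_n]\<close>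
  recovers \<open>I\<close>.\<close>

definition ci_span :: "nat \<Rightarrow> (nat \<Rightarrow> nat) \<Rightarrow> 'k::comm_ring_1 mpolynomial set" where
  "ci_span n d = {f. \<forall>m\<in>Poly_Mapping.keys f. \<exists>i\<le>n. d i \<le> Poly_Mapping.lookup m i}"

lemma ci_span_zero: "0 \<in> ci_span n d"
  by (simp add: ci_span_def)

lemma ci_span_add: "f \<in> ci_span n d \<Longrightarrow> g \<in> ci_span n d \<Longrightarrow> f + g \<in> ci_span n d"
  using keys_add[of f g] by (auto simp: ci_span_def)

lemma ci_span_uminus: "f \<in> ci_span n d \<Longrightarrow> - f \<in> ci_span n d"
  by (auto simp: ci_span_def in_keys_iff)

lemma ci_span_diff: "f \<in> ci_span n d \<Longrightarrow> g \<in> ci_span n d \<Longrightarrow> f - g \<in> ci_span n d"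
  using ci_span_add[of f n d "- g"] by (simp add: ci_span_uminus)

lemma ci_span_sum:
  "(\<And>i. i \<in> S \<Longrightarrow> f i \<in> ci_span n d) \<Longrightarrow> sum f S \<in> ci_span n d"
  by (induction S rule: infinite_finite_induct) (auto intro: ci_span_zero ci_span_add)

lemma ci_span_mult: "f \<in> ci_span n d \<Longrightarrow> g * f \<in> ci_span n d"
  unfolding ci_span_def
proof safe
  fix m assume f: "\<forall>m\<in>Poly_Mapping.keys f. \<exists>i\<le>n. d i \<le> Poly_Mapping.lookup m i"
    and "m \<in> Poly_Mapping.keys (g * f)"
  then obtain a b where "m = a + b" "b \<in> Poly_Mapping.keys f" using keys_mult[of g f] by blast
  with f show "\<exists>i\<le>n. d i \<le> Poly_Mapping.lookup m i"
    by (metis lookup_add le_add2 le_trans)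
qed

lemma ci_span_single:
  "i \<le> n \<Longrightarrow> d i \<le> Poly_Mapping.lookup m i \<Longrightarrow> Poly_Mapping.single m c \<in> ci_span n d"
  by (auto simp: ci_span_def)

lemma sum_in_ideal:
  assumes "ideal I (poly_ring n)" "\<And>i. i \<in> S \<Longrightarrow> f i \<in> I"
  shows "sum f S \<in> I"
proof -
  interpret ideal I "poly_ring n" by fact
  show ?thesis
    using assms(2)
  proof (induction S rule: infinite_finite_induct)
    case (insert x F)
    then have "f x \<oplus>\<^bsub>poly_ring n\<^esub> sum f F \<in> I"
      by (intro additive_subgroup.a_closed[OF additive_subgroup_axioms]) auto
    with insert show ?case by (simp add: poly_ring_def)
  qed (use additive_subgroup.zero_closed[OF additive_subgroup_axioms] in \<open>auto simp: poly_ring_def\<close>)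
qed

lemma poly_ring_a_inv: "f \<in> carrier (poly_ring n) \<Longrightarrow> \<ominus>\<^bsub>poly_ring n\<^esub> f = - f"
proof -
  interpret R: cring "poly_ring n :: 'a mpolynomial ring" by (rule cring_poly_ring)
  assume f: "f \<in> carrier (poly_ring n)"
  show ?thesis
  proof (rule R.minus_equality)
    show "- f \<in> carrier (poly_ring n)" using f by (auto simp: poly_ring_def in_keys_iff)
  qed (use f in \<open>auto simp: poly_ring_def\<close>)
qed

text \<open>One inclusion is minimality of the generated ideal. For the other, a polynomial splits
  into its terms, and each term is a multiple of some generator \<open>x_i^(d i)\<close>.\<close>

lemma monomial_ci_ideal_eq: "monomial_ci_ideal n d = carrier (poly_ring n) \<inter> ci_span n d"
proof
  interpret R: cring "poly_ring n :: 'a mpolynomial ring" by (rule cring_poly_ring)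
  have sub: "{var i ^ d i | i. i \<le> n} \<subseteq> carrier (poly_ring n :: 'a mpolynomial ring)"
    by (auto intro: var_power_in_carrier)
  have "ideal (carrier (poly_ring n) \<inter> ci_span n d) (poly_ring n :: 'a mpolynomial ring)"
  proof (rule idealI)
    show "subgroup (carrier (poly_ring n) \<inter> ci_span n d)
            (add_monoid (poly_ring n :: 'a mpolynomial ring))"
    proof
      fix f g :: "'a mpolynomial"
      assume fg: "f \<in> carrier (poly_ring n) \<inter> ci_span n d" "g \<in> carrier (poly_ring n) \<inter> ci_span n d"
      then have "f \<oplus>\<^bsub>poly_ring n\<^esub> g \<in> carrier (poly_ring n)" by (intro R.a_closed) auto
      with fg show "f \<otimes>\<^bsub>add_monoid (poly_ring n)\<^esub> g \<in> carrier (poly_ring n) \<inter> ci_span n d"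
        by (auto simp: poly_ring_def intro: ci_span_add)
    next
      fix f :: "'a mpolynomial"
      assume f: "f \<in> carrier (poly_ring n) \<inter> ci_span n d"
      then have "inv\<^bsub>add_monoid (poly_ring n)\<^esub> f = - f" using poly_ring_a_inv[of f n] by (simp add: a_inv_def)
      moreover have "- f \<in> carrier (poly_ring n)" using f by (auto simp: poly_ring_def in_keys_iff)
      ultimately show "inv\<^bsub>add_monoid (poly_ring n)\<^esub> f \<in> carrier (poly_ring n) \<inter> ci_span n d"
        using f by (auto intro: ci_span_uminus)
    qed (auto simp: poly_ring_def ci_span_zero)
  next
    fix f g :: "'a mpolynomial"
    assume fg: "f \<in> carrier (poly_ring n) \<inter> ci_span n d" "g \<in> carrier (poly_ring n)"
    then have "g \<otimes>\<^bsub>poly_ring n\<^esub> f \<in> carrier (poly_ring n)" by (intro R.m_closed) auto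
    with fg show "g \<otimes>\<^bsub>poly_ring n\<^esub> f \<in> carrier (poly_ring n) \<inter> ci_span n d"
      by (auto simp: poly_ring_def intro: ci_span_mult)
    have "f \<otimes>\<^bsub>poly_ring n\<^esub> g \<in> carrier (poly_ring n)" using fg by (intro R.m_closed) auto
    with fg show "f \<otimes>\<^bsub>poly_ring n\<^esub> g \<in> carrier (poly_ring n) \<inter> ci_span n d"
      using ci_span_mult[of f n d g] by (auto simp: poly_ring_def mult.commute)
  qed (rule R.ring_axioms)
  moreover have "{var i ^ d i | i. i \<le> n} \<subseteq> carrier (poly_ring n) \<inter> (ci_span n d :: 'a mpolynomial set)"
    by (auto simp: var_power intro!: ci_span_single) (auto simp: poly_ring_def split: if_splits)
  ultimately show "monomial_ci_ideal n d \<subseteq> carrier (poly_ring n) \<inter> (ci_span n d :: 'a mpolynomial set)"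
    unfolding monomial_ci_ideal_def by (rule R.genideal_minimal)
next
  let ?I = "monomial_ci_ideal n d :: 'a mpolynomial set"
  interpret ideal ?I "poly_ring n" by (rule ideal_monomial_ci_ideal)
  show "carrier (poly_ring n) \<inter> ci_span n d \<subseteq> ?I"
  proof
    fix f :: "'a mpolynomial"
    assume f: "f \<in> carrier (poly_ring n) \<inter> ci_span n d"
    have "Poly_Mapping.single m c \<in> ?I" if "m \<in> Poly_Mapping.keys f" for m c
    proof -
      obtain i where i: "i \<le> n" "d i \<le> Poly_Mapping.lookup m i"
        using f \<open>m \<in> Poly_Mapping.keys f\<close> by (auto simp: ci_span_def)
      let ?b = "m - Poly_Mapping.single i (d i)"
      have m: "m = ?b + Poly_Mapping.single i (d i)"
        using i by (intro poly_mapping_eqI) (auto simp: lookup_add lookup_minus lookup_single when_def)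
      have "var i ^ d i \<in> ?I"
        unfolding monomial_ci_ideal_def using i
        by (intro subsetD[OF genideal_self]) (auto intro: var_power_in_carrier)
      moreover have "Poly_Mapping.keys ?b \<subseteq> Poly_Mapping.keys m"
        by (auto simp: in_keys_iff lookup_minus)
      then have "Poly_Mapping.single ?b c \<in> carrier (poly_ring n)"
        using f \<open>m \<in> Poly_Mapping.keys f\<close> by (auto simp: poly_ring_def split: if_splits)
      ultimately have "Poly_Mapping.single ?b c \<otimes>\<^bsub>poly_ring n\<^esub> var i ^ d i \<in> ?I"
        by (rule I_l_closed)
      then show ?thesis
        by (simp add: poly_ring_def var_power mult_single flip: m)
    qed
    then have "(\<Sum>m\<in>Poly_Mapping.keys f. Poly_Mapping.single m (Poly_Mapping.lookup f m)) \<in> ?I"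
      by (intro sum_in_ideal[OF ideal_monomial_ci_ideal])
    then show "f \<in> ?I"
      by (simp flip: poly_mapping_sum_single)
  qed
qed

section \<open>Multiplication by a linear form, expressed on polynomial representatives\<close>

lemma coset_eq_iff:
  assumes "f \<in> carrier (poly_ring n)" "g \<in> carrier (poly_ring n)"
  shows "monomial_ci_ideal n d +>\<^bsub>poly_ring n\<^esub> f = monomial_ci_ideal n d +>\<^bsub>poly_ring n\<^esub> g
           \<longleftrightarrow> f - g \<in> ci_span n d"
proof -
  interpret ideal "monomial_ci_ideal n d" "poly_ring n" by (rule ideal_monomial_ci_ideal)
  have "f \<ominus>\<^bsub>poly_ring n\<^esub> g = f - g"
    using poly_ring_a_inv[OF assms(2)] by (simp add: a_minus_def) (simp add: poly_ring_def)
  moreover have "f \<ominus>\<^bsub>poly_ring n\<^esub> g \<in> carrier (poly_ring n)"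
    using assms by (rule minus_closed)
  ultimately show ?thesis
    using quotient_eq_iff_same_a_r_cos[OF ideal_axioms assms] by (simp add: monomial_ci_ideal_eq)
qed

lemma coset_mult:
  assumes "f \<in> carrier (poly_ring n)" "g \<in> carrier (poly_ring n)"
  shows "(monomial_ci_ideal n d +>\<^bsub>poly_ring n\<^esub> f) \<otimes>\<^bsub>poly_ring n Quot monomial_ci_ideal n d\<^esub>
           (monomial_ci_ideal n d +>\<^bsub>poly_ring n\<^esub> g) = monomial_ci_ideal n d +>\<^bsub>poly_ring n\<^esub> (f * g)"
proof -
  interpret ideal "monomial_ci_ideal n d" "poly_ring n" by (rule ideal_monomial_ci_ideal)
  show ?thesis
    using rcoset_mult_add[OF assms] by (simp add: FactRing_def) (simp add: poly_ring_def)
qed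

text \<open>Multiplication on the quotient is additive, so a trivial kernel is the same as
  injectivity; this form avoids comparing two cosets.\<close>

definition mult_inj :: "nat \<Rightarrow> (nat \<Rightarrow> nat) \<Rightarrow> 'k::comm_ring_1 mpolynomial \<Rightarrow> int \<Rightarrow> bool" where
  "mult_inj n d L j \<longleftrightarrow> (\<forall>f\<in>homogeneous_polys n j. L * f \<in> ci_span n d \<longrightarrow> f \<in> ci_span n d)"

definition mult_surj :: "nat \<Rightarrow> (nat \<Rightarrow> nat) \<Rightarrow> 'k::comm_ring_1 mpolynomial \<Rightarrow> int \<Rightarrow> bool" where
  "mult_surj n d L j \<longleftrightarrow>
     (\<forall>g\<in>homogeneous_polys n (j + 1). \<exists>f\<in>homogeneous_polys n j. g - L * f \<in> ci_span n d)"

lemma inj_on_quotient_iff: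
  assumes L: "L \<in> homogeneous_polys n 1"
  shows "inj_on (\<lambda>a. (monomial_ci_ideal n d +>\<^bsub>poly_ring n\<^esub> L)
             \<otimes>\<^bsub>poly_ring n Quot monomial_ci_ideal n d\<^esub> a)
           (quotient_component n (monomial_ci_ideal n d) j) \<longleftrightarrow> mult_inj n d L j"
    (is "inj_on ?M ?Q \<longleftrightarrow> _")
proof -
  let ?c = "\<lambda>f. monomial_ci_ideal n d +>\<^bsub>poly_ring n\<^esub> f"
  have LH: "L * f \<in> homogeneous_polys n (j + 1)" if "f \<in> homogeneous_polys n j" for f
    using homogeneous_polys_mult[OF L that] by (simp add: add.commute)
  have M: "?M (?c f) = ?c (L * f)" if "f \<in> homogeneous_polys n j" for f
    using coset_mult homogeneous_polys_carrier L that by blast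
  have eq: "?M (?c f) = ?M (?c g) \<longleftrightarrow> L * (f - g) \<in> ci_span n d" "?c f = ?c g \<longleftrightarrow> f - g \<in> ci_span n d"
    if "f \<in> homogeneous_polys n j" "g \<in> homogeneous_polys n j" for f g
    using that coset_eq_iff[of "L * f" n "L * g" d] coset_eq_iff[of f n g d]
    by (simp_all add: M LH[THEN homogeneous_polys_carrier] homogeneous_polys_carrier right_diff_distrib)
  show ?thesis
  proof
    assume inj: "inj_on ?M ?Q"
    show "mult_inj n d L j"
      unfolding mult_inj_def
    proof safe
      fix f assume f: "f \<in> homogeneous_polys n j" "L * f \<in> ci_span n d"
      then have "?M (?c f) = ?M (?c 0)" using eq(1)[of f 0] by (simp add: homogeneous_polys_zero)
      then have "?c f = ?c 0"
        by (rule inj_onD[OF inj]) (auto simp: quotient_component_def f homogeneous_polys_zero)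
      then show "f \<in> ci_span n d" using eq(2)[of f 0] f by (simp add: homogeneous_polys_zero)
    qed
  next
    assume inj: "mult_inj n d L j"
    show "inj_on ?M ?Q"
    proof (rule inj_onI)
      fix a b assume "a \<in> ?Q" "b \<in> ?Q" and ab: "?M a = ?M b"
      then obtain f g where fg: "f \<in> homogeneous_polys n j" "g \<in> homogeneous_polys n j"
        and "a = ?c f" "b = ?c g" by (auto simp: quotient_component_def)
      with ab show "a = b"
        using eq[OF fg] inj homogeneous_polys_diff[OF fg] by (auto simp: mult_inj_def)
    qed
  qed
qed

lemma image_quotient_eq_iff:
  assumes L: "L \<in> homogeneous_polys n 1"
  shows "(\<lambda>a. (monomial_ci_ideal n d +>\<^bsub>poly_ring n\<^esub> L)
             \<otimes>\<^bsub>poly_ring n Quot monomial_ci_ideal n d\<^esub> a)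
           ` quotient_component n (monomial_ci_ideal n d) j
             = quotient_component n (monomial_ci_ideal n d) (j + 1) \<longleftrightarrow> mult_surj n d L j"
proof -
  let ?c = "\<lambda>f. monomial_ci_ideal n d +>\<^bsub>poly_ring n\<^esub> f"
  have LH: "L * f \<in> homogeneous_polys n (j + 1)" if "f \<in> homogeneous_polys n j" for f
    using homogeneous_polys_mult[OF L that] by (simp add: add.commute)
  have "(\<lambda>a. ?c L \<otimes>\<^bsub>poly_ring n Quot monomial_ci_ideal n d\<^esub> a) ` quotient_component n (monomial_ci_ideal n d) j
          = (\<lambda>f. ?c (L * f)) ` homogeneous_polys n j"
    unfolding quotient_component_def image_image
    by (intro image_cong refl coset_mult homogeneous_polys_carrier[OF L] homogeneous_polys_carrier[of _ n j])
  moreover have "(\<lambda>f. ?c (L * f)) ` homogeneous_polys n j \<subseteq> quotient_component n (monomial_ci_ideal n d) (j + 1)"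
    unfolding quotient_component_def by (auto intro: LH)
  moreover have "quotient_component n (monomial_ci_ideal n d) (j + 1) \<subseteq> (\<lambda>f. ?c (L * f)) ` homogeneous_polys n j
          \<longleftrightarrow> mult_surj n d L j"
  proof -
    have "?c g = ?c (L * f) \<longleftrightarrow> g - L * f \<in> ci_span n d"
      if "g \<in> homogeneous_polys n (j + 1)" "f \<in> homogeneous_polys n j" for f g
      using that by (intro coset_eq_iff homogeneous_polys_carrier[of _ n "j + 1"] LH)
    then show ?thesis
      unfolding quotient_component_def mult_surj_def image_subset_iff by (auto simp: image_iff)
  qed
  ultimately show ?thesis by auto
qed

lemma weak_Lefschetz_iff:
  "weak_Lefschetz (poly_ring n Quot monomial_ci_ideal n d)
     (quotient_component n (monomial_ci_ideal n d :: 'k::comm_ring_1 mpolynomial set))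
     \<longleftrightarrow> (\<exists>L\<in>homogeneous_polys n 1 :: 'k mpolynomial set. \<forall>j. mult_inj n d L j \<or> mult_surj n d L j)"
proof -
  have bex: "(\<exists>a\<in>quotient_component n J i. P a) \<longleftrightarrow>
      (\<exists>L\<in>homogeneous_polys n i. P (J +>\<^bsub>poly_ring n\<^esub> L))"
    for P i and J :: "'k mpolynomial set"
    by (auto simp: quotient_component_def)
  show ?thesis
    unfolding weak_Lefschetz_def bex
    by (intro bex_cong refl) (simp only: inj_on_quotient_iff image_quotient_eq_iff)
qed

section \<open>Propagation of injectivity and failure in characteristic p\<close>

text \<open>The degree of the socle monomial, the product of all \<open>x_i^(d i - 1)\<close>. It is
  an integer so that complementary degrees can be formed without truncation.\<close>

definition socle_degree :: "nat \<Rightarrow> (nat \<Rightarrow> nat) \<Rightarrow> int" where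
  "socle_degree n d = (\<Sum>i\<le>n. int (d i) - 1)"

lemma notin_ci_span_iff:
  "f \<notin> ci_span n d \<longleftrightarrow> (\<exists>m\<in>Poly_Mapping.keys f. \<forall>i\<le>n. Poly_Mapping.lookup m i < d i)"
  by (simp add: ci_span_def) (meson not_le)

lemma ci_span_of_degree:
  assumes f: "f \<in> homogeneous_polys n j" and j: "socle_degree n d < j"
  shows "f \<in> ci_span n d"
proof (rule ccontr)
  assume "f \<notin> ci_span n d"
  then obtain m where m: "m \<in> Poly_Mapping.keys f" "\<forall>i\<le>n. Poly_Mapping.lookup m i < d i"
    by (auto simp: notin_ci_span_iff)
  have "j = (\<Sum>i\<le>n. int (Poly_Mapping.lookup m i))"
    using f m(1) mon_degree_atMost[of m n] by (auto simp: homogeneous_polys_iff)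
  also have "\<dots> \<le> socle_degree n d"
    unfolding socle_degree_def using m(2) by (intro sum_mono) force
  finally show False using j by simp
qed

text \<open>A surviving monomial below the socle degree has some exponent under
  \<open>d i - 1\<close>, which can still be raised. Multiplication by a single variable only shifts
  the support, so nothing cancels.\<close>

lemma var_mult_notin_ci_span:
  assumes f: "f \<in> homogeneous_polys n j" "f \<notin> ci_span n d" and j: "j < socle_degree n d"
  obtains i where "i \<le> n" "var i * f \<notin> ci_span n d"
proof -
  obtain m where m: "m \<in> Poly_Mapping.keys f" "\<forall>i\<le>n. Poly_Mapping.lookup m i < d i"
    using f(2) by (auto simp: notin_ci_span_iff)
  have "(\<Sum>i\<le>n. int (Poly_Mapping.lookup m i)) < socle_degree n d"
    using f(1) m(1) j mon_degree_atMost[of m n] by (auto simp: homogeneous_polys_iff)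
  then obtain i where i: "i \<le> n" "int (Poly_Mapping.lookup m i) < int (d i) - 1"
    unfolding socle_degree_def by (meson atMost_iff not_le sum_mono)
  have "m + Poly_Mapping.single i 1 \<in> Poly_Mapping.keys (var i * f)"
    using m(1) by (simp add: in_keys_iff lookup_var_mult_add del: One_nat_def)
  moreover have "\<forall>k\<le>n. Poly_Mapping.lookup (m + Poly_Mapping.single i 1) k < d k"
    using m(2) i by (auto simp: lookup_add lookup_single when_def)
  ultimately show ?thesis using i(1) that by (force simp: notin_ci_span_iff)
qed

text \<open>For \<open>j + k\<close> equal to the socle degree this is the nondegeneracy of the
  pairing into the socle.\<close>

lemma mult_notin_ci_span:
  assumes f: "f \<in> homogeneous_polys n j" "f \<notin> ci_span n d" and j: "j + int k \<le> socle_degree n d"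
  shows "\<exists>g\<in>homogeneous_polys n (int k). g * f \<notin> ci_span n d"
  using j
proof (induction k)
  case 0
  show ?case by (rule bexI[of _ 1]) (use f homogeneous_polys_one in auto)
next
  case (Suc k)
  then obtain g where g: "g \<in> homogeneous_polys n (int k)" "g * f \<notin> ci_span n d" by auto
  obtain i where i: "i \<le> n" "var i * (g * f) \<notin> ci_span n d"
    using var_mult_notin_ci_span[OF homogeneous_polys_mult[OF g(1) f(1)] g(2)] Suc.prems by auto
  have "var i * g \<in> homogeneous_polys n (1 + int k)"
    using homogeneous_polys_mult homogeneous_polys_var[OF i(1)] g(1) by blast
  with i show ?case by (intro bexI[of _ "var i * g"]) (auto simp: mult.assoc)
qed

text \<open>A nonzero kernel element of degree \<open>k\<close> has a nonzero multiple in degree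
  \<open>j\<close>, and \<open>L\<close> kills that multiple as well.\<close>

lemma mult_inj_downward:
  assumes inj: "mult_inj n d L j" and j: "k \<le> j" "j \<le> socle_degree n d"
  shows "mult_inj n d L k"
  unfolding mult_inj_def
proof safe
  fix f assume f: "f \<in> homogeneous_polys n k" "L * f \<in> ci_span n d"
  show "f \<in> ci_span n d"
  proof (rule ccontr)
    assume "f \<notin> ci_span n d"
    then obtain g where g: "g \<in> homogeneous_polys n (j - k)" "g * f \<notin> ci_span n d"
      using mult_notin_ci_span[OF f(1), of d "nat (j - k)"] j by auto
    have "L * (g * f) \<in> ci_span n d"
      using ci_span_mult[OF f(2), of g] by (simp add: mult_ac)
    moreover have "g * f \<in> homogeneous_polys n j"
      using homogeneous_polys_mult[OF g(1) f(1)] by simp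
    ultimately show False using inj g(2) by (auto simp: mult_inj_def)
  qed
qed

text \<open>If \<open>L * f = 0\<close> and \<open>g = L * h\<close> modulo \<open>I\<close>, then
  \<open>f * g = h * (L * f) = 0\<close>. So \<open>f\<close> pairs to zero with all of degree
  \<open>j + 1\<close>, which forces \<open>f = 0\<close>.\<close>

lemma mult_surj_imp_mult_inj:
  assumes surj: "mult_surj n d L j" and j: "-1 \<le> j"
  shows "mult_inj n d L (socle_degree n d - j - 1)"
  unfolding mult_inj_def
proof safe
  fix f assume f: "f \<in> homogeneous_polys n (socle_degree n d - j - 1)" "L * f \<in> ci_span n d"
  show "f \<in> ci_span n d"
  proof (rule ccontr)
    assume "f \<notin> ci_span n d"
    then obtain g where g: "g \<in> homogeneous_polys n (j + 1)" "g * f \<notin> ci_span n d"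
      using mult_notin_ci_span[OF f(1), of d "nat (j + 1)"] j by auto
    obtain h where "g - L * h \<in> ci_span n d"
      using surj g(1) by (auto simp: mult_surj_def)
    then have "f * (g - L * h) + h * (L * f) \<in> ci_span n d"
      by (intro ci_span_add ci_span_mult f)
    with g(2) show False by (simp add: algebra_simps)
  qed
qed

text \<open>Injectivity in degree \<open>j\<close> would give injectivity in every degree from
  \<open>e\<close> to \<open>j\<close>, so none of the products \<open>L ^ k * f\<close> with
  \<open>k <= q\<close> could vanish in the quotient.\<close>

lemma not_mult_inj:
  assumes L: "L \<in> homogeneous_polys n 1" and f: "f \<in> homogeneous_polys n e" "f \<notin> ci_span n d"
    and q: "L ^ q * f \<in> ci_span n d" and j: "e + int q = j + 1" "j \<le> socle_degree n d"
  shows "\<not> mult_inj n d L j"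
proof
  assume inj: "mult_inj n d L j"
  have "L ^ k * f \<notin> ci_span n d" if "k \<le> q" for k
    using that
  proof (induction k)
    case (Suc k)
    have "L ^ k * f \<in> homogeneous_polys n (int k + e)"
      using homogeneous_polys_mult[OF homogeneous_polys_power[OF L] f(1)] by simp
    moreover have "mult_inj n d L (int k + e)"
      using mult_inj_downward[OF inj] j Suc.prems by simp
    ultimately show ?case using Suc by (auto simp: mult_inj_def mult.assoc)
  qed (use f in simp)
  with q show False by blast
qed

text \<open>The bound places the complementary degree \<open>socle_degree n d - j - 1\<close> at or
  above \<open>j\<close>, so injectivity there would descend to \<open>j\<close>.\<close>

lemma not_mult_surj:
  assumes "\<not> mult_inj n d L j" "-1 \<le> j" "2 * j + 1 \<le> socle_degree n d"
  shows "\<not> mult_surj n d L j"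
  using mult_surj_imp_mult_inj[of n d L j] mult_inj_downward[of n d L "socle_degree n d - j - 1" j] assms
  by auto

section \<open>Powers of linear forms in characteristic p\<close>

lemma CHAR_poly_mapping:
  "CHAR('a::comm_monoid_add \<Rightarrow>\<^sub>0 'b::comm_semiring_1) = CHAR('b)"
proof (rule CHAR_eqI)
  show "of_nat CHAR('b) = (0 :: 'a \<Rightarrow>\<^sub>0 'b)"
    by (simp flip: single_of_nat)
next
  fix k assume "of_nat k = (0 :: 'a \<Rightarrow>\<^sub>0 'b)"
  then have "Poly_Mapping.lookup (of_nat k :: 'a \<Rightarrow>\<^sub>0 'b) 0 = 0" by simp
  then show "CHAR('b) dvd k"
    by (simp add: lookup_of_nat of_nat_eq_0_iff_char_dvd)
qed

lemma single_power:
  fixes a :: "'a \<Rightarrow>\<^sub>0 nat" and c :: "'b::comm_semiring_1"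
  obtains b where "Poly_Mapping.single a c ^ q = Poly_Mapping.single b (c ^ q)"
    "\<And>i. Poly_Mapping.lookup b i = q * Poly_Mapping.lookup a i"
proof -
  have "\<exists>b. Poly_Mapping.single a c ^ q = Poly_Mapping.single b (c ^ q) \<and>
          (\<forall>i. Poly_Mapping.lookup b i = q * Poly_Mapping.lookup a i)"
  proof (induction q)
    case (Suc q)
    then obtain b where "Poly_Mapping.single a c ^ q = Poly_Mapping.single b (c ^ q)"
      "\<forall>i. Poly_Mapping.lookup b i = q * Poly_Mapping.lookup a i" by blast
    then show ?case by (intro exI[of _ "a + b"]) (simp add: mult_single lookup_add)
  qed (auto intro!: exI[of _ 0])
  with that show thesis by blast
qed

text \<open>Frobenius turns \<open>L ^ (p ^ m)\<close> into a combination of the powers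
  \<open>x_i^(p^m)\<close>. These lie in the ideal for \<open>i > 0\<close>, and the power of
  \<open>x_0\<close> does after multiplication by \<open>x_0^e\<close>.\<close>

lemma linear_power_mult_in_ci_span:
  fixes L :: "'k::comm_ring_1 mpolynomial"
  assumes p: "prime p" "CHAR('k) = p" and L: "L \<in> homogeneous_polys n 1"
    and d: "\<And>i. 0 < i \<Longrightarrow> i \<le> n \<Longrightarrow> d i \<le> p ^ m" "d 0 \<le> p ^ m + e"
  shows "L ^ (p ^ m) * var 0 ^ e \<in> ci_span n d"
proof -
  have "L ^ (p ^ m) = (\<Sum>a\<in>Poly_Mapping.keys L. Poly_Mapping.single a (Poly_Mapping.lookup L a) ^ (p ^ m))"
    by (subst (1) poly_mapping_sum_single[of L], rule freshmans_dream_sum')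
      (use p in \<open>simp_all add: CHAR_poly_mapping\<close>)
  moreover have "Poly_Mapping.single a (Poly_Mapping.lookup L a) ^ (p ^ m) * var 0 ^ e \<in> ci_span n d"
    if a: "a \<in> Poly_Mapping.keys L" for a
  proof -
    obtain b where b: "Poly_Mapping.single a (Poly_Mapping.lookup L a) ^ (p ^ m)
        = Poly_Mapping.single b (Poly_Mapping.lookup L a ^ (p ^ m))"
      "\<And>i. Poly_Mapping.lookup b i = p ^ m * Poly_Mapping.lookup a i" using single_power by blast
    have "mon_degree a = 1" "Poly_Mapping.keys a \<subseteq> {..n}"
      using L a by (auto simp: homogeneous_polys_iff)
    moreover from this(1) have "Poly_Mapping.keys a \<noteq> {}"
      by (auto simp: mon_degree_def)
    then obtain i where ia: "i \<in> Poly_Mapping.keys a" by blast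
    ultimately have i: "i \<le> n" "1 \<le> Poly_Mapping.lookup a i"
      using ia by (auto simp: Suc_le_eq dest: subsetD) (simp add: in_keys_iff)
    have "d i \<le> Poly_Mapping.lookup (b + Poly_Mapping.single 0 e) i"
    proof (cases "i = 0")
      case True
      have "p ^ m * 1 \<le> p ^ m * Poly_Mapping.lookup a 0" using i True by (intro mult_le_mono) auto
      with d(2) have "d 0 \<le> p ^ m * Poly_Mapping.lookup a 0 + e" by linarith
      with True show ?thesis by (simp add: lookup_add b(2))
    next
      case False
      have "p ^ m * 1 \<le> p ^ m * Poly_Mapping.lookup a i" using i by (intro mult_le_mono) auto
      with d(1)[of i] False i have "d i \<le> p ^ m * Poly_Mapping.lookup a i" by linarith
      then show ?thesis by (simp add: lookup_add b(2))
    qed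
    with i(1) show ?thesis
      by (simp add: b(1) var_power mult_single ci_span_single)
  qed
  ultimately show ?thesis
    by (simp add: sum_distrib_right ci_span_sum)
qed

section \<open>The lowering operator\<close>

text \<open>The lowering operator \<open>x\<^sub>i^a \<mapsto> a (e - a) x\<^sub>i^(a - 1)\<close> of the \<open>sl\<^sub>2\<close>-module \<open>K[x\<^sub>i]/(x\<^sub>i^e)\<close>,
  extended to all polynomials; for \<open>a = e\<close> the coefficient vanishes, so the ideal is preserved.\<close>

definition lower_var :: "nat \<Rightarrow> nat \<Rightarrow> 'k::comm_ring_1 mpolynomial \<Rightarrow> 'k mpolynomial" where
  "lower_var e i f =
     Poly_Mapping.map_key (\<lambda>m. m + Poly_Mapping.single i 1)
       (Poly_Mapping.mapp (\<lambda>m c. of_int (int (Poly_Mapping.lookup m i) * (int e - int (Poly_Mapping.lookup m i))) * c) f)"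

text \<open>The coefficient at \<open>m\<close> comes from the exponent \<open>a = m_i + 1\<close>
  that is being lowered, so the factor is \<open>a (e - a)\<close> at that shifted value.\<close>

lemma lookup_lower_var:
  "Poly_Mapping.lookup (lower_var e i f) m =
     of_int ((int (Poly_Mapping.lookup m i) + 1) * (int e - int (Poly_Mapping.lookup m i) - 1)) *
       Poly_Mapping.lookup f (m + Poly_Mapping.single i 1)"
proof -
  have "inj (\<lambda>m :: nat \<Rightarrow>\<^sub>0 nat. m + Poly_Mapping.single i 1)"
    by (intro injI) simp
  then show ?thesis
    unfolding lower_var_def
    by (simp add: Poly_Mapping.map_key.rep_eq lookup_mapp lookup_add in_keys_iff when_def algebra_simps)
qed

lemma lower_var_add: "lower_var e i (f + g) = lower_var e i f + lower_var e i g"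
  by (rule poly_mapping_eqI) (simp add: lookup_lower_var lookup_add algebra_simps del: One_nat_def)

lemma lower_var_var_mult_other:
  assumes "i \<noteq> k"
  shows "lower_var e k (var i * f) = var i * lower_var e k f"
proof (rule poly_mapping_eqI)
  fix m :: "nat \<Rightarrow>\<^sub>0 nat"
  have "m + Poly_Mapping.single k 1 - Poly_Mapping.single i 1
      = m - Poly_Mapping.single i 1 + Poly_Mapping.single k 1"
    if "Poly_Mapping.lookup m i \<noteq> 0"
    using that by (intro poly_mapping_eqI) (auto simp: lookup_add lookup_minus lookup_single when_def)
  then show "Poly_Mapping.lookup (lower_var e k (var i * f)) m = Poly_Mapping.lookup (var i * lower_var e k f) m"
    using assms
    by (auto simp: lookup_lower_var lookup_var_mult lookup_add lookup_minus lookup_single_not_eq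
        simp del: One_nat_def)
qed

text \<open>The commutator in one variable:
  \<open>(a + 1)(e - a - 1) - a (e - a) = e - 1 - 2a\<close>, the weight of \<open>x^a\<close> up to
  the sign convention.\<close>

lemma lookup_lower_var_var_mult_same:
  "Poly_Mapping.lookup (lower_var e i (var i * f)) m =
     Poly_Mapping.lookup (var i * lower_var e i f) m
     + of_int (int e - 1 - 2 * int (Poly_Mapping.lookup m i)) * Poly_Mapping.lookup f m"
proof -
  have 1: "Poly_Mapping.lookup (lower_var e i (var i * f)) m =
      of_int ((int (Poly_Mapping.lookup m i) + 1) * (int e - int (Poly_Mapping.lookup m i) - 1)) * Poly_Mapping.lookup f m"
    by (simp only: lookup_lower_var lookup_var_mult_add)
  have 2: "Poly_Mapping.lookup (var i * lower_var e i f) m =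
      of_int (int (Poly_Mapping.lookup m i) * (int e - int (Poly_Mapping.lookup m i))) * Poly_Mapping.lookup f m"
  proof (cases "Poly_Mapping.lookup m i = 0")
    case False
    then have "int (Poly_Mapping.lookup (m - Poly_Mapping.single i 1) i) = int (Poly_Mapping.lookup m i) - 1"
      by (simp add: lookup_minus of_nat_diff)
    with False show ?thesis
      by (simp add: lookup_var_mult lookup_lower_var sub_single_add del: One_nat_def)
  qed (simp add: lookup_var_mult)
  show ?thesis unfolding 1 2 by (simp add: algebra_simps)
qed

lemma lower_var_homogeneous:
  assumes f: "f \<in> homogeneous_polys n j" and i: "i \<le> n"
  shows "lower_var e i f \<in> homogeneous_polys n (j - 1)"
  unfolding homogeneous_polys_iff
proof
  fix m assume "m \<in> Poly_Mapping.keys (lower_var e i f)"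
  then have "m + Poly_Mapping.single i 1 \<in> Poly_Mapping.keys f"
    by (auto simp: in_keys_iff lookup_lower_var)
  then have "Poly_Mapping.keys (m + Poly_Mapping.single i 1) \<subseteq> {..n}"
    "int (mon_degree (m + Poly_Mapping.single i 1)) = j"
    using f by (auto simp: homogeneous_polys_iff)
  moreover have "Poly_Mapping.keys m \<subseteq> Poly_Mapping.keys (m + Poly_Mapping.single i 1)"
    by (auto simp: in_keys_iff lookup_add)
  ultimately show "Poly_Mapping.keys m \<subseteq> {..n} \<and> int (mon_degree m) = j - 1"
    by (auto simp: mon_degree_add)
qed

lemma lower_var_ci_span:
  assumes f: "f \<in> ci_span n d"
  shows "lower_var (d i) i f \<in> ci_span n d"
  unfolding ci_span_def
proof safe
  fix m assume m: "m \<in> Poly_Mapping.keys (lower_var (d i) i f)"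
  then have "m + Poly_Mapping.single i 1 \<in> Poly_Mapping.keys f"
    by (auto simp: in_keys_iff lookup_lower_var)
  then obtain k where k: "k \<le> n" "d k \<le> Poly_Mapping.lookup (m + Poly_Mapping.single i 1) k"
    using f by (auto simp: ci_span_def)
  \<comment> \<open>Only lowering \<open>x_i^(d i)\<close> to \<open>x_i^(d i - 1)\<close> could
    leave the ideal, and that coefficient is zero.\<close>
  have "d i \<noteq> Poly_Mapping.lookup m i + 1"
  proof
    assume "d i = Poly_Mapping.lookup m i + 1"
    then have "Poly_Mapping.lookup (lower_var (d i) i f) m = 0"
      by (simp add: lookup_lower_var)
    with m show False by (simp add: in_keys_iff)
  qed
  then have "d k \<le> Poly_Mapping.lookup m k"
    using k by (cases "i = k") (auto simp: lookup_add lookup_single_not_eq)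
  with k show "\<exists>k\<le>n. d k \<le> Poly_Mapping.lookup m k" by blast
qed

text \<open>The operator \<open>F\<close> of the overview: on a tensor product of modules a Lie
  algebra element acts as the sum of its actions on the factors.\<close>

definition lowering :: "nat \<Rightarrow> (nat \<Rightarrow> nat) \<Rightarrow> 'k::comm_ring_1 mpolynomial \<Rightarrow> 'k mpolynomial" where
  "lowering n d f = (\<Sum>i\<le>n. lower_var (d i) i f)"

lemma lowering_add: "lowering n d (f + g) = lowering n d f + lowering n d g"
  by (simp add: lowering_def lower_var_add sum.distrib)

lemma lowering_of_int_mult: "lowering n d (of_int c * f) = of_int c * lowering n d f"
  by (rule poly_mapping_eqI)
    (simp add: lowering_def lookup_sum lookup_lower_var lookup_of_int_mult sum_distrib_left mult.left_commute)

lemma lowering_homogeneous: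
  "f \<in> homogeneous_polys n j \<Longrightarrow> lowering n d f \<in> homogeneous_polys n (j - 1)"
  unfolding lowering_def by (intro homogeneous_polys_sum lower_var_homogeneous) auto

lemma lowering_ci_span: "f \<in> ci_span n d \<Longrightarrow> lowering n d f \<in> ci_span n d"
  unfolding lowering_def by (intro ci_span_sum lower_var_ci_span)

definition var_sum :: "nat \<Rightarrow> 'k::comm_ring_1 mpolynomial" where
  "var_sum n = (\<Sum>i\<le>n. var i)"

lemma var_sum_homogeneous: "var_sum n \<in> homogeneous_polys n 1"
  unfolding var_sum_def by (intro homogeneous_polys_sum homogeneous_polys_var) simp

lemma var_sum_mult_homogeneous:
  "f \<in> homogeneous_polys n j \<Longrightarrow> var_sum n * f \<in> homogeneous_polys n (j + 1)"
  using homogeneous_polys_mult[OF var_sum_homogeneous, of f n j] by (simp add: add.commute)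

text \<open>The \<open>sl\<^sub>2\<close> relation; it holds in the polynomial ring itself, before passing to the quotient.\<close>

lemma lowering_var_sum_mult:
  assumes f: "f \<in> homogeneous_polys n j"
  shows "lowering n d (var_sum n * f) = var_sum n * lowering n d f + of_int (socle_degree n d - 2 * j) * f"
proof (rule poly_mapping_eqI)
  fix m :: "nat \<Rightarrow>\<^sub>0 nat"
  let ?lk = "Poly_Mapping.lookup"
  have lv_sum: "lower_var e k (sum g S) = (\<Sum>i\<in>S. lower_var e k (g i))" for e k and g :: "nat \<Rightarrow> 'a mpolynomial" and S
    by (rule poly_mapping_eqI) (simp add: lookup_lower_var lookup_sum sum_distrib_left)
  have "?lk (lowering n d (var_sum n * f)) m = (\<Sum>k\<le>n. \<Sum>i\<le>n. ?lk (lower_var (d k) k (var i * f)) m)"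
    by (simp add: lowering_def var_sum_def sum_distrib_right lv_sum lookup_sum)
  also have "\<dots> = (\<Sum>k\<le>n. \<Sum>i\<le>n. ?lk (var i * lower_var (d k) k f) m
      + (if i = k then of_int (int (d k) - 1 - 2 * int (?lk m k)) * ?lk f m else 0))"
    \<comment> \<open>Terms with \<open>i\<close> different from \<open>k\<close> commute; each
      diagonal term contributes its one-variable weight.\<close>
    by (intro sum.cong refl) (simp add: lookup_lower_var_var_mult_same lower_var_var_mult_other)
  also have "\<dots> = (\<Sum>k\<le>n. \<Sum>i\<le>n. ?lk (var i * lower_var (d k) k f) m)
      + (\<Sum>k\<le>n. of_int (int (d k) - 1 - 2 * int (?lk m k)) * ?lk f m)"
    by (simp add: sum.distrib)
  also have "(\<Sum>k\<le>n. \<Sum>i\<le>n. ?lk (var i * lower_var (d k) k f) m) = ?lk (var_sum n * lowering n d f) m"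
    by (simp add: lowering_def var_sum_def sum_distrib_left sum_distrib_right lookup_sum)
  also have "(\<Sum>k\<le>n. of_int (int (d k) - 1 - 2 * int (?lk m k)) * ?lk f m)
      = of_int (\<Sum>k\<le>n. int (d k) - 1 - 2 * int (?lk m k)) * ?lk f m"
    by (simp only: of_int_sum sum_distrib_right)
  also have "\<dots> = of_int (socle_degree n d - 2 * j) * ?lk f m"
  \<comment> \<open>On the support of \<open>f\<close> the exponents of \<open>m\<close> add up to
    \<open>j\<close>, so the weights add up to the scalar claimed; off the support both sides
    vanish.\<close>
  proof (cases "m \<in> Poly_Mapping.keys f")
    case True
    then have "j = (\<Sum>k\<le>n. int (?lk m k))"
      using f mon_degree_atMost[of m n] by (auto simp: homogeneous_polys_iff)
    then have "(\<Sum>k\<le>n. int (d k) - 1 - 2 * int (?lk m k)) = socle_degree n d - 2 * j"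
      by (simp add: socle_degree_def sum_subtractf sum_distrib_left)
    then show ?thesis by simp
  qed (simp add: in_keys_iff)
  finally show "?lk (lowering n d (var_sum n * f)) m
      = ?lk (var_sum n * lowering n d f + of_int (socle_degree n d - 2 * j) * f) m"
    by (simp only: lookup_add lookup_of_int_mult)
qed

lemma lowering_funpow_homogeneous:
  "f \<in> homogeneous_polys n j \<Longrightarrow> (lowering n d ^^ k) f \<in> homogeneous_polys n (j - int k)"
proof (induction k)
  case (Suc k)
  then show ?case using lowering_homogeneous[of "(lowering n d ^^ k) f" n "j - int k" d]
    by (simp add: algebra_simps)
qed simp

lemma lowering_funpow_ci_span: "f \<in> ci_span n d \<Longrightarrow> (lowering n d ^^ k) f \<in> ci_span n d"
  by (induction k) (auto intro: lowering_ci_span)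

text \<open>Moving \<open>k + 1\<close> copies of \<open>F\<close> past the sum of the variables
  meets the degrees \<open>j, j - 1, ..., j - k\<close>. With \<open>s\<close> the socle degree, the
  weights \<open>s - 2 (j - i)\<close> for \<open>i = 0, ..., k\<close> sum to
  \<open>(k + 1) (s - 2 j + k)\<close>.\<close>

lemma lowering_funpow_var_sum_mult:
  assumes f: "f \<in> homogeneous_polys n j"
  shows "(lowering n d ^^ Suc k) (var_sum n * f) = var_sum n * (lowering n d ^^ Suc k) f
           + of_int ((int k + 1) * (socle_degree n d - 2 * j + int k)) * (lowering n d ^^ k) f"
proof (induction k)
  case 0
  show ?case using lowering_var_sum_mult[OF f] by simp
next
  case (Suc k)
  let ?F = "lowering n d" and ?s = "socle_degree n d"
  have "(?F ^^ Suc (Suc k)) (var_sum n * f)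
      = ?F (var_sum n * (?F ^^ Suc k) f + of_int ((int k + 1) * (?s - 2 * j + int k)) * (?F ^^ k) f)"
    using Suc by simp
  also have "\<dots> = ?F (var_sum n * (?F ^^ Suc k) f)
      + of_int ((int k + 1) * (?s - 2 * j + int k)) * (?F ^^ Suc k) f"
    unfolding lowering_add lowering_of_int_mult by simp
  also have "?F (var_sum n * (?F ^^ Suc k) f) = var_sum n * (?F ^^ Suc (Suc k)) f
      + of_int (?s - 2 * (j - int (Suc k))) * (?F ^^ Suc k) f"
    using lowering_var_sum_mult[OF lowering_funpow_homogeneous[OF f, where d = d and k = "Suc k"], of d] by simp
  finally have "(?F ^^ Suc (Suc k)) (var_sum n * f) = var_sum n * (?F ^^ Suc (Suc k)) f
      + of_int (?s - 2 * (j - int (Suc k)) + (int k + 1) * (?s - 2 * j + int k)) * (?F ^^ Suc k) f"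
    by (simp only: of_int_add distrib_right add.assoc)
  also have "?s - 2 * (j - int (Suc k)) + (int k + 1) * (?s - 2 * j + int k)
      = (int (Suc k) + 1) * (?s - 2 * j + int (Suc k))"
    by (simp add: algebra_simps)
  finally show ?case .
qed

section \<open>Maximal rank for the sum of the variables in large characteristic\<close>

lemma of_int_mult_in_ci_span:
  fixes f :: "'k::field mpolynomial"
  assumes "of_int c * f \<in> ci_span n d" "of_int c \<noteq> (0 :: 'k)"
  shows "f \<in> ci_span n d"
  using assms by (auto simp: ci_span_def in_keys_iff lookup_of_int_mult)

lemma of_int_mult_neq_0:
  assumes "prime p" "CHAR('k::field) = p" "0 < a" "a < int p" "0 < b" "b < int p"
  shows "of_int (a * b) \<noteq> (0 :: 'k)"
proof -
  have "of_int x \<noteq> (0 :: 'k)" if "0 < x" "x < int p" for x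
  proof -
    have "\<not> p dvd nat x" using that by (auto dest!: dvd_imp_le)
    then have "of_nat (nat x) \<noteq> (0 :: 'k)" using assms(2) by (simp add: of_nat_eq_0_iff_char_dvd)
    with that show ?thesis by simp
  qed
  with assms show ?thesis by simp
qed

lemma var_sum_mult_inj:
  assumes p: "prime p" "CHAR('k::field) = p"
    and j: "0 \<le> j" "2 * j < socle_degree n d" "socle_degree n d - j < int p"
  shows "mult_inj n d (var_sum n :: 'k mpolynomial) j"
  unfolding mult_inj_def
proof safe
  fix f :: "'k mpolynomial" assume f: "f \<in> homogeneous_polys n j" "var_sum n * f \<in> ci_span n d"
  have "(lowering n d ^^ k) f \<in> ci_span n d" if "k \<le> nat j + 1" for k
    using that
  proof (induction k rule: inc_induct)
    \<comment> \<open>\<open>F^(j + 1) f\<close> has degree \<open>-1\<close>, hence is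
      zero.\<close>
    case base
    have "(lowering n d ^^ (nat j + 1)) f \<in> homogeneous_polys n (- 1)"
      using lowering_funpow_homogeneous[OF f(1), where d = d and k = "nat j + 1"] j by simp
    then show ?case by (simp add: homogeneous_polys_neg ci_span_zero)
  next
    case (step k)
    \<comment> \<open>Both terms lie in the ideal, the first because the product
      \<open>var_sum n * f\<close> does, the second by the induction hypothesis; what remains is a
      scalar multiple of \<open>F^k f\<close>.\<close>
    have "(lowering n d ^^ Suc k) (var_sum n * f) - var_sum n * (lowering n d ^^ Suc k) f \<in> ci_span n d"
      by (intro ci_span_diff ci_span_mult step lowering_funpow_ci_span f)
    then have "of_int ((int k + 1) * (socle_degree n d - 2 * j + int k)) * (lowering n d ^^ k) f \<in> ci_span n d"
      unfolding lowering_funpow_var_sum_mult[OF f(1)] by (simp add: algebra_simps)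
    \<comment> \<open>As \<open>k <= j\<close>, both factors lie between 1 and
      \<open>socle_degree n d - j\<close>, which is below \<open>p\<close>.\<close>
    moreover have "of_int ((int k + 1) * (socle_degree n d - 2 * j + int k)) \<noteq> (0 :: 'k)"
      using step.hyps j by (intro of_int_mult_neq_0[OF p]) auto
    ultimately show ?case by (rule of_int_mult_in_ci_span)
  qed
  from this[of 0] show "f \<in> ci_span n d" by simp
qed

lemma var_sum_mult_surj:
  assumes p: "prime p" "CHAR('k::field) = p"
    and j: "0 \<le> j" "socle_degree n d \<le> 2 * j + 1" "j + 1 < int p"
  shows "mult_surj n d (var_sum n :: 'k mpolynomial) j"
  unfolding mult_surj_def
proof
  fix g :: "'k mpolynomial" assume g: "g \<in> homogeneous_polys n (j + 1)"
  \<comment> \<open>Chosen so that degree \<open>j + 1 + ?N\<close> exceeds the socle degree and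
    every \<open>h\<close> there is zero in the quotient. The induction keeps \<open>h\<close>
    arbitrary because its step replaces \<open>h\<close> by \<open>var_sum n * h\<close>.\<close>
  let ?N = "nat (socle_degree n d - j)"
  have "\<exists>u\<in>homogeneous_polys n j. (lowering n d ^^ k) h - var_sum n * u \<in> ci_span n d"
    if "k \<le> ?N" "h \<in> homogeneous_polys n (j + 1 + int k)" for k and h :: "'k mpolynomial"
    using that
  proof (induction k arbitrary: h rule: inc_induct)
    case base
    then have "h \<in> ci_span n d" by (intro ci_span_of_degree[of h n "j + 1 + int ?N"]) auto
    then show ?case
      by (intro bexI[of _ 0]) (auto intro: lowering_funpow_ci_span homogeneous_polys_zero)
  next
    case (step k)
    let ?c = "(int k + 1) * (socle_degree n d - 2 * (j + 1 + int k) + int k)"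
    let ?e = "Poly_Mapping.single 0 (inverse (of_int ?c)) :: 'k mpolynomial"
    have "?c = - ((int k + 1) * (2 * j + 2 + int k - socle_degree n d))" by (simp add: algebra_simps)
    \<comment> \<open>As \<open>k < ?N\<close>, both factors lie between 1 and \<open>j + 1\<close>,
      which is below \<open>p\<close>.\<close>
    moreover have "of_int ((int k + 1) * (2 * j + 2 + int k - socle_degree n d)) \<noteq> (0 :: 'k)"
      using step.hyps j by (intro of_int_mult_neq_0[OF p]) auto
    ultimately have c: "of_int ?c \<noteq> (0 :: 'k)" by (simp only: of_int_minus neg_equal_0_iff_equal not_False_eq_True)
    have "?e * of_int ?c = Poly_Mapping.single 0 (inverse (of_int ?c) * of_int ?c)"
      by (simp only: mult_single add_0 flip: single_of_int)
    also have "inverse (of_int ?c) * of_int ?c = (1 :: 'k)"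
      using c by (rule left_inverse)
    finally have e: "?e * of_int ?c = 1"
      by (simp only: single_one)
    have "var_sum n * h \<in> homogeneous_polys n (j + 1 + int (Suc k))"
      using var_sum_mult_homogeneous[OF step.prems] by (simp add: algebra_simps)
    then obtain u where u: "u \<in> homogeneous_polys n j"
      "(lowering n d ^^ Suc k) (var_sum n * h) - var_sum n * u \<in> ci_span n d"
      using step.IH by blast
    \<comment> \<open>Obtained by solving the commutation relation for \<open>F^k h\<close>, with
      \<open>F^(k + 1)\<close> of \<open>var_sum n * h\<close> replaced by
      \<open>var_sum n * u\<close> modulo the ideal; \<open>?e\<close> is the inverse of the
      coefficient \<open>?c\<close>.\<close>
    let ?v = "?e * (u - (lowering n d ^^ Suc k) h)"
    have "(lowering n d ^^ Suc k) h \<in> homogeneous_polys n j"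
      using lowering_funpow_homogeneous[OF step.prems, where d = d and k = "Suc k"] by simp
    then have "?v \<in> homogeneous_polys n j"
      by (intro homogeneous_polys_const_mult homogeneous_polys_diff u)
    moreover have "?e * ((lowering n d ^^ Suc k) (var_sum n * h) - var_sum n * u)
        = (lowering n d ^^ k) h - var_sum n * ?v"
    proof -
      have "?e * ((lowering n d ^^ Suc k) (var_sum n * h) - var_sum n * u)
          = (?e * of_int ?c) * (lowering n d ^^ k) h - var_sum n * ?v"
        unfolding lowering_funpow_var_sum_mult[OF step.prems] by (simp only: algebra_simps)
      then show ?thesis using e by simp
    qed
    ultimately show ?case using ci_span_mult[OF u(2), of ?e] by (intro bexI[of _ ?v]) simp_all
  qed
  from this[of 0 g] g show "\<exists>f\<in>homogeneous_polys n j. g - var_sum n * f \<in> ci_span n d" by simp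
qed

text \<open>A monomial of positive degree is a variable times a monomial of degree one less. A
  preimage for the smaller monomial, times that variable, is a preimage for the larger one;
  linearity does the rest.\<close>

lemma mult_surj_Suc:
  assumes surj: "mult_surj n d L j" and j: "-1 \<le> j"
  shows "mult_surj n d L (j + 1)"
  unfolding mult_surj_def
proof
  fix g :: "'a mpolynomial" assume g: "g \<in> homogeneous_polys n (j + 1 + 1)"
  let ?P = "\<lambda>g. \<exists>f\<in>homogeneous_polys n (j + 1). g - L * f \<in> ci_span n d"
  have "?P (Poly_Mapping.single m c)" if m: "m \<in> Poly_Mapping.keys g" for m c
  proof -
    have deg: "int (mon_degree m) = j + 1 + 1" and sub: "Poly_Mapping.keys m \<subseteq> {..n}"
      using g m by (auto simp: homogeneous_polys_iff)
    have "Poly_Mapping.keys m \<noteq> {}" using deg j by (auto simp: mon_degree_def)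
    with sub obtain i where i: "i \<in> Poly_Mapping.keys m" "i \<le> n" by blast
    let ?b = "m - Poly_Mapping.single i 1"
    have m_eq: "?b + Poly_Mapping.single i 1 = m" using i by (intro sub_single_add) (simp add: in_keys_iff)
    have "Poly_Mapping.keys ?b \<subseteq> Poly_Mapping.keys m" by (auto simp: in_keys_iff lookup_minus)
    with sub have "Poly_Mapping.keys ?b \<subseteq> {..n}" by blast
    moreover have "int (mon_degree ?b) = j + 1"
      using deg mon_degree_add[of ?b "Poly_Mapping.single i 1"] unfolding m_eq by simp
    ultimately have "Poly_Mapping.single ?b c \<in> homogeneous_polys n (j + 1)"
      by (rule homogeneous_polys_single)
    then obtain u where u: "u \<in> homogeneous_polys n j" "Poly_Mapping.single ?b c - L * u \<in> ci_span n d"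
      using surj by (auto simp: mult_surj_def)
    have "var i * (Poly_Mapping.single ?b c - L * u) = Poly_Mapping.single m c - L * (var i * u)"
      using m_eq by (simp add: var_def mult_single right_diff_distrib mult_ac add.commute del: One_nat_def)
    then have "Poly_Mapping.single m c - L * (var i * u) \<in> ci_span n d"
      using ci_span_mult[OF u(2), of "var i"] by simp
    moreover have "var i * u \<in> homogeneous_polys n (j + 1)"
      using homogeneous_polys_mult[OF homogeneous_polys_var[OF i(2)] u(1)] by (simp add: add.commute)
    ultimately show ?thesis by blast
  qed
  then have "\<forall>m\<in>Poly_Mapping.keys g. \<exists>f. f \<in> homogeneous_polys n (j + 1) \<and>
      Poly_Mapping.single m (Poly_Mapping.lookup g m) - L * f \<in> ci_span n d"
    by blast
  from bchoice[OF this] obtain u where u: "\<And>m. m \<in> Poly_Mapping.keys g \<Longrightarrow> u m \<in> homogeneous_polys n (j + 1)"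
    "\<And>m. m \<in> Poly_Mapping.keys g \<Longrightarrow> Poly_Mapping.single m (Poly_Mapping.lookup g m) - L * u m \<in> ci_span n d"
    by blast
  have "(\<Sum>m\<in>Poly_Mapping.keys g. Poly_Mapping.single m (Poly_Mapping.lookup g m) - L * u m) \<in> ci_span n d"
    by (intro ci_span_sum u)
  then have "g - L * (\<Sum>m\<in>Poly_Mapping.keys g. u m) \<in> ci_span n d"
    by (simp add: sum_subtractf sum_distrib_left flip: poly_mapping_sum_single)
  then show "?P g"
    by (intro bexI[of _ "\<Sum>m\<in>Poly_Mapping.keys g. u m"] homogeneous_polys_sum u)
qed

lemma mult_surj_upward:
  assumes "mult_surj n d L j" "-1 \<le> j" "j \<le> k"
  shows "mult_surj n d L k"
  using assms(3,1,2)
proof (induction k rule: int_ge_induct)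
  case (step i)
  then show ?case using mult_surj_Suc[of n d L i] by simp
qed

text \<open>Serves both cases of (i): subtraction on naturals makes the exponent
  \<open>d 0 - p ^ m\<close> zero when \<open>p ^ m\<close> is at least \<open>d 0\<close>, and
  adding \<open>p ^ m\<close> back gives the maximum.\<close>

lemma not_mult_inj_prime_power:
  fixes L :: "'k::field mpolynomial"
  assumes p: "prime p" "CHAR('k) = p" and L: "L \<in> homogeneous_polys n 1"
    and d: "\<And>i. i \<le> n \<Longrightarrow> 0 < d i" "\<And>i. 0 < i \<Longrightarrow> i \<le> n \<Longrightarrow> d i \<le> p ^ m"
    and le: "int (max (d 0) (p ^ m)) - 1 \<le> socle_degree n d"
  shows "\<not> mult_inj n d L (int (max (d 0) (p ^ m)) - 1)"
proof (rule not_mult_inj[OF L])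
  let ?e = "d 0 - p ^ m"
  show "var 0 ^ ?e \<in> homogeneous_polys n (int ?e)"
    using homogeneous_polys_power[OF homogeneous_polys_var[of 0 n], of ?e] by simp
  show "var 0 ^ ?e \<notin> ci_span n d"
    using d(1) p(1) by (auto simp: notin_ci_span_iff var_power lookup_single when_def prime_gt_0_nat)
  show "L ^ (p ^ m) * var 0 ^ ?e \<in> ci_span n d"
    by (rule linear_power_mult_in_ci_span[OF p L d(2)]) auto
  show "int ?e + int (p ^ m) = int (max (d 0) (p ^ m)) - 1 + 1"
    by (auto simp: max_def of_nat_diff)
qed (rule le)

theorem proposition3p5:
  fixes n p t :: nat
    and d :: "nat \<Rightarrow> nat"
    and R :: "'k::field mpolynomial ring"
    and I :: "'k mpolynomial set"
    and A :: "'k mpolynomial set ring"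
    and G :: "int \<Rightarrow> 'k mpolynomial set set"
    and l :: "'k mpolynomial set"
  assumes n: "n \<ge> 2"
    and d_decreasing: "\<forall>i<n. d i \<ge> d (Suc i)"
    and d_ge_2: "d n \<ge> 2"
    and t: "t = (\<Sum>i\<le>n. d i) - (n + 1)"
    and K_infinite: "infinite (UNIV :: 'k set)"
    and p_prime: "prime p"
    and K_char: "CHAR('k) = p"
    and R: "R = poly_ring n"
    and I: "I = monomial_ci_ideal n d"
    and A: "A = R Quot I"
    and G: "G = quotient_component n I"
    and l: "l = I +>\<^bsub>R\<^esub> (\<Sum>i\<le>n. var i)"
    and d0_le: "int (d 0) \<le> \<lceil>real t / 2\<rceil>"
  shows "((d 1 \<le> p \<and> p \<le> d 0) \<or> (\<exists>m>0. d 0 \<le> p ^ m \<and> int (p ^ m) \<le> \<lceil>real t / 2\<rceil>)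
             \<longrightarrow> \<not> weak_Lefschetz A G)
       \<and> (d 1 \<le> p \<and> p \<le> d 0
             \<longrightarrow> \<not> inj_on (\<lambda>a. l \<otimes>\<^bsub>A\<^esub> a) (G (int (d 0) - 1)))
       \<and> (\<forall>m>0. d 0 \<le> p ^ m \<and> int (p ^ m) \<le> \<lceil>real t / 2\<rceil>
             \<longrightarrow> \<not> inj_on (\<lambda>a. l \<otimes>\<^bsub>A\<^esub> a) (G (int (p ^ m) - 1)))
       \<and> (int p > \<lceil>(real t + 1) / 2\<rceil> \<longrightarrow> weak_Lefschetz A G)"
proof -
  have d_antimono: "d j \<le> d i" if "i \<le> j" "j \<le> n" for i j
    using that
  proof (induction j rule: dec_induct)
    case (step j)
    then show ?case using d_decreasing by (auto intro: order_trans[of _ "d j"])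
  qed simp
  then have d_ge: "2 \<le> d i" if "i \<le> n" for i
    using d_ge_2 that by (meson le_trans order_refl)
  \<comment> \<open>This makes the natural-number subtraction defining \<open>t\<close> exact and
    \<open>t\<close> positive.\<close>
  have "(\<Sum>i\<le>n. 2) \<le> (\<Sum>i\<le>n. d i)"
    using d_ge by (intro sum_mono) auto
  then have s: "socle_degree n d = int t" and t_pos: "1 \<le> t"
    using n by (simp_all add: socle_degree_def t sum_subtractf of_nat_diff)
  have ceil: "2 * int c \<le> int t + 1" if "int c \<le> \<lceil>real t / 2\<rceil>" for c
    using that by (simp add: le_ceiling_iff)
  have wl: "weak_Lefschetz A G \<longleftrightarrow>
      (\<exists>L\<in>homogeneous_polys n 1 :: 'k mpolynomial set. \<forall>j. mult_inj n d L j \<or> mult_surj n d L j)"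
    unfolding A G R I by (rule weak_Lefschetz_iff)
  have inj: "inj_on (\<lambda>a. l \<otimes>\<^bsub>A\<^esub> a) (G j) \<longleftrightarrow> mult_inj n d (var_sum n :: 'k mpolynomial) j" for j
    unfolding l A G R I var_sum_def[symmetric] by (rule inj_on_quotient_iff[OF var_sum_homogeneous])
  \<comment> \<open>Stated for every linear form, since failure of the weak Lefschetz property must
    exclude all of them.\<close>
  have fail: "\<not> mult_inj n d L (int (max (d 0) (p ^ m)) - 1)
      \<and> \<not> mult_surj n d L (int (max (d 0) (p ^ m)) - 1)"
    if L: "L \<in> homogeneous_polys n 1" and m: "d 1 \<le> p ^ m" "int (max (d 0) (p ^ m)) \<le> \<lceil>real t / 2\<rceil>"
    for L :: "'k mpolynomial" and m
  proof -
    have j: "2 * (int (max (d 0) (p ^ m)) - 1) + 1 \<le> socle_degree n d"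
      using ceil[OF m(2)] s by simp
    have d: "d i \<le> p ^ m" if "0 < i" "i \<le> n" for i
      using d_antimono[of 1 i] that m(1) by simp
    have "\<not> mult_inj n d L (int (max (d 0) (p ^ m)) - 1)"
      using d_ge[of 0] j by (intro not_mult_inj_prime_power p_prime K_char L d) (auto dest: d_ge)
    moreover from this have "\<not> mult_surj n d L (int (max (d 0) (p ^ m)) - 1)"
      using j by (intro not_mult_surj) auto
    ultimately show ?thesis ..
  qed
  have fail1: "\<not> mult_inj n d L (int (d 0) - 1) \<and> \<not> mult_surj n d L (int (d 0) - 1)"
    if "d 1 \<le> p \<and> p \<le> d 0" "L \<in> homogeneous_polys n 1" for L :: "'k mpolynomial"
    using fail[OF that(2), of 1] that(1) d0_le by (simp add: max_absorb1)
  have fail2: "\<not> mult_inj n d L (int (p ^ m) - 1) \<and> \<not> mult_surj n d L (int (p ^ m) - 1)"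
    if "d 0 \<le> p ^ m \<and> int (p ^ m) \<le> \<lceil>real t / 2\<rceil>" "L \<in> homogeneous_polys n 1"
    for L :: "'k mpolynomial" and m
  proof -
    have "d 1 \<le> p ^ m" using d_antimono[of 0 1] n that(1) by simp
    moreover have "max (d 0) (p ^ m) = p ^ m" using that(1) by simp
    ultimately show ?thesis using fail[OF that(2), of m] that(1) by simp
  qed
  have holds: "weak_Lefschetz A G" if "int p > \<lceil>(real t + 1) / 2\<rceil>"
  proof -
    have p: "int t + 3 \<le> 2 * int p"
      using that unfolding ceiling_less_iff by simp
    \<comment> \<open>The largest degree with \<open>2 * k < t\<close>. Injectivity holds up to
      \<open>k\<close> and surjectivity from \<open>t - k - 1\<close> on; since
      \<open>t - k - 1 <= k + 1\<close>, no degree is missed.\<close>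
    define k where "k = (int t - 1) div 2"
    have k: "2 * k < int t" "int t \<le> 2 * k + 2" "0 \<le> k"
      using t_pos unfolding k_def by linarith+
    have inj_k: "mult_inj n d (var_sum n :: 'k mpolynomial) k"
      using k p by (intro var_sum_mult_inj[OF p_prime K_char]) (auto simp: s)
    have surj_k: "mult_surj n d (var_sum n :: 'k mpolynomial) (int t - k - 1)"
      using k p by (intro var_sum_mult_surj[OF p_prime K_char]) (auto simp: s)
    have "mult_inj n d (var_sum n :: 'k mpolynomial) j \<or> mult_surj n d (var_sum n :: 'k mpolynomial) j" for j
    proof (cases "j \<le> k")
      case True
      then show ?thesis using mult_inj_downward[OF inj_k, of j] k by (simp add: s)
    next
      case False
      then show ?thesis using mult_surj_upward[OF surj_k, of j] k by simp
    qed
    then show ?thesis unfolding wl using var_sum_homogeneous by blast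
  qed
  show ?thesis
    unfolding inj
    using fail1 fail2 holds var_sum_homogeneous[of n, where ?'a = 'k] by (auto simp: wl; blast)
qed

end
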